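(* Let $X$ be a nonempty set equipped with a separated uniformity $\mathscr U$ generated by a nonempty family $\mathscr F$ of pseudometrics with associated collection $\mathscr V$ of basic entourages, and let $G$ be a directed graph with $V(G)=X$ and $E(G)\supseteq\Delta(X)$. Let $X$ be sequentially complete and let $T:X\to X$ be a Banach $G$-contraction. If $T$ is nonexpansive or the family $\{T^n:n\ge1\}$ is equicontinuous on $X$, then $T|_{\overline{[x]_{\widetilde G}}}$ is a Picard operator for all $x\in X$ with $Tx\in[x]_{\widetilde G}$, where $\overline{[x]_{\widetilde G}}$ denotes the closure of $[x]_{\widetilde G}$ in $X$. In particular, if $G$ is weakly connected, then each nonexpansive Banach $G$-contraction on $X$ is a Picard operator.
   Context: Uniform structure: $\mathscr U$ is a uniformity on $X$; separated means $\bigcap\mathscr U=\Delta(X)=\{(x,x):x\in X\}$. Convergence and closure are in the uniform topology; $X$ is sequentially complete if every Cauchy sequence converges. $\mathscr F$ is a nonempty family of (uniformly continuous) pseudometrics on $X$ generating $\mathscr U$. For a pseudometric $\rho$ and $r>0$ put $V(\rho,r)=\{(x,y)\in X\times X:\rho(x,y)<r\}$. $\mathscr V$ is the collection of all sets $\bigcap_{i=1}^m V(\rho_i,r_i)$ with $m\ge1$, $\rho_i\in\mathscr F$, $r_i>0$; it is a base of $\mathscr U$ and its members are called basic entourages. For $V=\bigcap_{i=1}^mV(\rho_i,r_i)\in\mathscr V$ and $\alpha>0$, put $\alpha V=\bigcap_{i=1}^mV(\rho_i,\alpha r_i)$ (a basic entourage is regarded as given together with such a presentation, and $\alpha V$ is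 formed from it). Graphs: $G$ has vertex set $X$ and edge set $E(G)\subseteq X\times X$ (directed, no parallel edges) containing all loops. $\widetilde G$ has vertex set $X$ and $E(\widetilde G)=\{(x,y):(x,y)\in E(G)\text{ or }(y,x)\in E(G)\}$. $[x]_{\widetilde G}$ is the set of all $y\in X$ joined to $x$ by a path in $\widetilde G$, i.e. a finite sequence $x_0=x,\dots,x_N=y$ with $(x_{i-1},x_i)\in E(\widetilde G)$ for $i=1,\dots,N$. $G$ is weakly connected if $[x]_{\widetilde G}=X$ for all $x\in X$. A mapping $T:X\to X$ is a Banach $G$-contraction if (B1) $(x,y)\in E(G)$ implies $(Tx,Ty)\in E(G)$ for all $x,y\in X$; and (B2) there is $\alpha\in(0,1)$ such that $(x,y)\in V\cap E(G)$ implies $(Tx,Ty)\in\alpha V$ for all $x,y\in X$ and all $V\in\mathscr V$. $T$ is nonexpansive if $(x,y)\in V$ implies $(Tx,Ty)\in V$ for all $x,y\in X$ and all $V\in\mathscr V$. The family $\{T^n:n\ge1\}$ is equicontinuous on $X$ if for each $x\in X$ and each $V\in\mathscr U$ there is $W\in\mathscr U$ such that $(T^nx,T^ny)\in V$ for all $n\ge1$ and all $y\in X$ with $(x,y)\in W$. $T$ is a Picard operator if it has a unique fixed point $x^*$ and $T^nx\to x^*$ for all $x$ in its domain. For $A\subseteq X$, saying that $T|_A$ is a Picard operator means that $T(A)\subseteq A$ and that $T|_A:A\to A$ is a Picard operator (with fixed point in $A$). *)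

theory Defs
  imports "HOL-Analysis.Analysis"
begin

definition entourages :: "('a::uniform_space \<times> 'a) set set" where
  "entourages = {U. eventually (\<lambda>p. p \<in> U) uniformity}"

definition separated_uniformity :: "'a::uniform_space itself \<Rightarrow> bool" where
  "separated_uniformity _ \<longleftrightarrow> \<Inter> (entourages :: ('a \<times> 'a) set set) = Id"

definition sequentially_complete :: "'a::uniform_space itself \<Rightarrow> bool" where
  "sequentially_complete _ \<longleftrightarrow> (\<forall>s :: nat \<Rightarrow> 'a. Cauchy s \<longrightarrow> convergent s)"

definition pseudometric :: "('a \<Rightarrow> 'a \<Rightarrow> real) \<Rightarrow> bool" where
  "pseudometric \<rho> \<longleftrightarrow>
     (\<forall>x y. 0 \<le> \<rho> x y) \<and> (\<forall>x. \<rho> x x = 0) \<and> (\<forall>x y. \<rho> x y = \<rho> y x) \<and>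
     (\<forall>x y z. \<rho> x z \<le> \<rho> x y + \<rho> y z)"

text \<open>
  A basic entourage carries its presentation: the list of pairs \<open>(\<rho>\<^sub>i, r\<^sub>i)\<close> stands for
  the finite intersection of the sets \<open>{(x, y). \<rho>\<^sub>i x y < r\<^sub>i}\<close>.  Scaling is an operation on
  presentations, since it is not determined by the underlying set of pairs.
\<close>

type_synonym 'a presentation = "(('a \<Rightarrow> 'a \<Rightarrow> real) \<times> real) list"

definition presentations :: "('a \<Rightarrow> 'a \<Rightarrow> real) set \<Rightarrow> 'a presentation set" where
  "presentations F = {P. P \<noteq> [] \<and> (\<forall>(\<rho>, r) \<in> set P. \<rho> \<in> F \<and> 0 < r)}"

definition basic_entourage :: "'a presentation \<Rightarrow> ('a \<times> 'a) set" where
  "basic_entourage P = (\<Inter>(\<rho>, r) \<in> set P. {(x, y). \<rho> x y < r})"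

definition scale :: "real \<Rightarrow> 'a presentation \<Rightarrow> 'a presentation" where
  "scale \<alpha> P = map (\<lambda>(\<rho>, r). (\<rho>, \<alpha> * r)) P"

definition generates_uniformity :: "('a::uniform_space \<Rightarrow> 'a \<Rightarrow> real) set \<Rightarrow> bool" where
  "generates_uniformity F \<longleftrightarrow>
     (\<forall>U. U \<in> entourages \<longleftrightarrow> (\<exists>P \<in> presentations F. basic_entourage P \<subseteq> U))"

text \<open>A graph on the whole type is given by its edge relation \<open>E\<close>.\<close>

definition sym_edges :: "('a \<times> 'a) set \<Rightarrow> ('a \<times> 'a) set" where
  "sym_edges E = {(x, y). (x, y) \<in> E \<or> (y, x) \<in> E}"

definition component :: "('a \<times> 'a) set \<Rightarrow> 'a \<Rightarrow> 'a set" where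
  "component E x = {y. \<exists>N (p :: nat \<Rightarrow> 'a). p 0 = x \<and> p N = y \<and>
     (\<forall>i \<in> {1..N}. (p (i - 1), p i) \<in> sym_edges E)}"

definition weakly_connected :: "('a \<times> 'a) set \<Rightarrow> bool" where
  "weakly_connected E \<longleftrightarrow> (\<forall>x. component E x = UNIV)"

definition banach_contraction ::
  "('a \<Rightarrow> 'a \<Rightarrow> real) set \<Rightarrow> ('a \<times> 'a) set \<Rightarrow> ('a \<Rightarrow> 'a) \<Rightarrow> bool" where
  "banach_contraction F E T \<longleftrightarrow>
     (\<forall>x y. (x, y) \<in> E \<longrightarrow> (T x, T y) \<in> E) \<and>
     (\<exists>\<alpha>. 0 < \<alpha> \<and> \<alpha> < 1 \<and>
        (\<forall>x y. \<forall>P \<in> presentations F.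
           (x, y) \<in> basic_entourage P \<inter> E \<longrightarrow> (T x, T y) \<in> basic_entourage (scale \<alpha> P)))"

definition nonexpansive :: "('a \<Rightarrow> 'a \<Rightarrow> real) set \<Rightarrow> ('a \<Rightarrow> 'a) \<Rightarrow> bool" where
  "nonexpansive F T \<longleftrightarrow>
     (\<forall>x y. \<forall>P \<in> presentations F.
        (x, y) \<in> basic_entourage P \<longrightarrow> (T x, T y) \<in> basic_entourage P)"

definition equicontinuous_iterates :: "('a::uniform_space \<Rightarrow> 'a) \<Rightarrow> bool" where
  "equicontinuous_iterates T \<longleftrightarrow>
     (\<forall>x. \<forall>V \<in> entourages. \<exists>W \<in> entourages.
        \<forall>n \<ge> 1. \<forall>y. (x, y) \<in> W \<longrightarrow> ((T ^^ n) x, (T ^^ n) y) \<in> V)"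

text \<open>\<open>picard_on A T\<close>: the restriction of \<open>T\<close> to \<open>A\<close> is a Picard operator of \<open>A\<close>.\<close>

definition picard_on :: "'a::topological_space set \<Rightarrow> ('a \<Rightarrow> 'a) \<Rightarrow> bool" where
  "picard_on A T \<longleftrightarrow> T ` A \<subseteq> A \<and>
     (\<exists>z \<in> A. T z = z \<and> (\<forall>y \<in> A. T y = y \<longrightarrow> y = z) \<and>
        (\<forall>x \<in> A. (\<lambda>n. (T ^^ n) x) \<longlonglongrightarrow> z))"

end

theory Submission
  imports Defs
begin

text \<open>
  Each \<open>\<rho> \<in> F\<close> contracts along edges, so \<open>\<rho> (T\<^sup>n x) (T\<^sup>n y)\<close> decays geometrically when
  \<open>x\<close> and \<open>y\<close> are joined by a path.  Applied to \<open>x\<close> and \<open>T x\<close>, this makes the orbit of \<open>x\<close> Cauchy;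
  let \<open>z\<close> be its limit.  All orbits starting in the component of \<open>x\<close> then converge to \<open>z\<close>, and
  equicontinuity, which nonexpansiveness implies, carries this over to the closure.
\<close>

section \<open>Components of the graph and approximation of closure points\<close>

lemma component_eq_rtrancl: "component E x = {y. (x, y) \<in> (sym_edges E)\<^sup>*}"
proof -
  \<comment> \<open>Edges numbered from \<open>1\<close> to \<open>N\<close> are renumbered from
    \<open>0\<close>, the format of \<open>relpow_fun_conv\<close>; paths then become the reflexive
    transitive closure, which allows induction along a path.\<close>
  have shift: "(\<forall>i\<in>{1..N}. (p (i - 1), p i) \<in> R) \<longleftrightarrow> (\<forall>i<N. (p i, p (Suc i)) \<in> R)"
    for N and p :: "nat \<Rightarrow> 'a" and R
  proof safe
    fix i assume *: "\<forall>i\<in>{1..N}. (p (i - 1), p i) \<in> R" and "i < N"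
    then show "(p i, p (Suc i)) \<in> R"
      using bspec[OF *, of "Suc i"] by simp
  next
    fix i assume *: "\<forall>i<N. (p i, p (Suc i)) \<in> R" and "i \<in> {1..N}"
    then show "(p (i - 1), p i) \<in> R"
      using *[rule_format, of "i - 1"] by (cases i) auto
  qed
  show ?thesis
    unfolding component_def shift rtrancl_power relpow_fun_conv by auto
qed

lemma component_refl: "x \<in> component E x"
  by (simp add: component_eq_rtrancl)

lemma component_trans: "y \<in> component E x \<Longrightarrow> z \<in> component E y \<Longrightarrow> z \<in> component E x"
  by (simp add: component_eq_rtrancl)

text \<open>\<open>T\<close> sends edges to edges in either orientation, so it carries a path from
  \<open>x\<close> to \<open>y\<close>, edge by edge, to a path from \<open>T x\<close> to
  \<open>T y\<close>.\<close>

lemma component_image: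
  assumes "\<forall>(a, b) \<in> E. (T a, T b) \<in> E" and "y \<in> component E x"
  shows "T y \<in> component E (T x)"
proof -
  have "(x, y) \<in> (sym_edges E)\<^sup>*"
    using assms(2) by (simp add: component_eq_rtrancl)
  then have "(T x, T y) \<in> (sym_edges E)\<^sup>*"
  proof induction
    case (step y z)
    then have "(T y, T z) \<in> sym_edges E"
      using assms(1) by (auto simp: sym_edges_def)
    with step.IH show ?case ..
  qed simp
  then show ?thesis
    by (simp add: component_eq_rtrancl)
qed

text \<open>The component of \<open>T x\<close> lies inside that of \<open>x\<close>, so one more
  application of \<open>T\<close> does not leave it.\<close>

lemma funpow_mem_component:
  assumes "\<forall>(a, b) \<in> E. (T a, T b) \<in> E" and "T x \<in> component E x"
  shows "(T ^^ n) x \<in> component E x"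
proof (induction n)
  case (Suc n)
  from component_trans[OF assms(2) component_image[OF assms(1) Suc]] show ?case
    by simp
qed (simp add: component_refl)

lemma closure_obtain_eventually:
  assumes "y \<in> closure A" and "eventually P (nhds y)"
  obtains a where "a \<in> A" and "P a"
proof -
  obtain U where "open U" "y \<in> U" "\<And>u. u \<in> U \<Longrightarrow> P u"
    using assms(2) by (auto simp: eventually_nhds)
  moreover have "U \<inter> A \<noteq> {}"
    using open_Int_closure_eq_empty[OF \<open>open U\<close>, of A] assms(1) \<open>y \<in> U\<close> by blast
  ultimately show ?thesis
    using that by blast
qed

section \<open>Convergence, separation and equicontinuity expressed by pseudometrics\<close>

locale generating_pseudometrics =
  fixes F :: "('a::uniform_space \<Rightarrow> 'a \<Rightarrow> real) set"
  assumes pseudometric: "\<rho> \<in> F \<Longrightarrow> pseudometric \<rho>"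
    and generates: "generates_uniformity F"
begin

lemma nonneg: "\<rho> \<in> F \<Longrightarrow> 0 \<le> \<rho> x y"
  and refl: "\<rho> \<in> F \<Longrightarrow> \<rho> x x = 0"
  and commute: "\<rho> \<in> F \<Longrightarrow> \<rho> x y = \<rho> y x"
  and triangle: "\<rho> \<in> F \<Longrightarrow> \<rho> x z \<le> \<rho> x y + \<rho> y z"
  using pseudometric[of \<rho>] unfolding pseudometric_def by blast+

lemma basic_entourage_in_entourages: "P \<in> presentations F \<Longrightarrow> basic_entourage P \<in> entourages"
  using generates unfolding generates_uniformity_def by blast

lemma entourage_obtain:
  assumes "U \<in> entourages"
  obtains P where "P \<in> presentations F" and "basic_entourage P \<subseteq> U"
  using generates assms that unfolding generates_uniformity_def by blast

lemma singleton_presentation: "\<rho> \<in> F \<Longrightarrow> 0 < r \<Longrightarrow> [(\<rho>, r)] \<in> presentations F"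
  by (simp add: presentations_def)

lemma eventually_less_uniformity:
  assumes "\<rho> \<in> F" and "0 < r"
  shows "\<forall>\<^sub>F (x, y) in uniformity. \<rho> x y < r"
  using basic_entourage_in_entourages[OF singleton_presentation[OF assms]]
  by (simp add: entourages_def basic_entourage_def case_prod_beta')

lemma eventually_uniformity_obtain:
  assumes "eventually Q uniformity"
  obtains P where "P \<in> presentations F" and "\<And>x y. (x, y) \<in> basic_entourage P \<Longrightarrow> Q (x, y)"
proof -
  have "Collect Q \<in> entourages"
    using assms by (simp add: entourages_def)
  then obtain P where "P \<in> presentations F" "basic_entourage P \<subseteq> Collect Q"
    by (rule entourage_obtain)
  with that show ?thesis
    by blast
qed

text \<open>A presentation is a finite list, so its finitely many eventual inequalities hold
  simultaneously. Two moving points \<open>f t\<close> and \<open>g t\<close> let the same fact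
  serve both limits and Cauchy sequences.\<close>

lemma eventually_basic_entourage:
  assumes "P \<in> presentations F"
    and "\<And>\<rho> r. \<rho> \<in> F \<Longrightarrow> 0 < r \<Longrightarrow> eventually (\<lambda>t. \<rho> (f t) (g t) < r) G"
  shows "eventually (\<lambda>t. (f t, g t) \<in> basic_entourage P) G"
proof -
  have "eventually (\<lambda>t. \<forall>q \<in> set P. fst q (f t) (g t) < snd q) G"
    using assms by (intro eventually_ball_finite) (auto simp: presentations_def)
  then show ?thesis
    by (simp add: basic_entourage_def case_prod_beta')
qed

lemma tendsto_if:
  fixes l :: 'a
  assumes "\<And>\<rho> r. \<rho> \<in> F \<Longrightarrow> 0 < r \<Longrightarrow> eventually (\<lambda>t. \<rho> l (f t) < r) G"
  shows "(f \<longlongrightarrow> l) G"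
  unfolding filterlim_iff
proof (intro allI impI)
  fix Q assume "eventually Q (nhds l)"
  then have "\<forall>\<^sub>F p in uniformity. fst p = l \<longrightarrow> Q (snd p)"
    by (simp add: eventually_nhds_uniformity case_prod_beta')
  then obtain P where "P \<in> presentations F"
    and P: "\<And>x y. (x, y) \<in> basic_entourage P \<Longrightarrow> x = l \<longrightarrow> Q y"
    using eventually_uniformity_obtain[of "\<lambda>p. fst p = l \<longrightarrow> Q (snd p)"] by auto
  from eventually_basic_entourage[OF this(1) assms]
  show "eventually (\<lambda>t. Q (f t)) G"
    by (rule eventually_mono) (auto dest: P)
qed

lemma eventually_less_nhds:
  assumes "\<rho> \<in> F" and "0 < r"
  shows "\<forall>\<^sub>F y in nhds x. \<rho> x y < r"
  using eventually_less_uniformity[OF assms]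
  by (auto simp: eventually_nhds_uniformity elim: eventually_mono)

lemma eventually_less_tendsto:
  assumes "(f \<longlongrightarrow> l) G" and "\<rho> \<in> F" and "0 < r"
  shows "eventually (\<lambda>t. \<rho> l (f t) < r) G"
  using assms(1) eventually_less_nhds[OF assms(2,3)] by (auto simp: filterlim_iff)

lemma CauchyI_pseudometric:
  fixes s :: "nat \<Rightarrow> 'a"
  assumes "\<And>\<rho> r. \<rho> \<in> F \<Longrightarrow> 0 < r \<Longrightarrow> \<exists>N. \<forall>m\<ge>N. \<forall>n\<ge>N. \<rho> (s m) (s n) < r"
  shows "Cauchy s"
  unfolding Cauchy_uniform_iff
proof (intro allI impI)
  fix Q :: "'a \<times> 'a \<Rightarrow> bool" assume "eventually Q uniformity"
  then obtain P where P: "P \<in> presentations F" "\<And>x y. (x, y) \<in> basic_entourage P \<Longrightarrow> Q (x, y)"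
    using eventually_uniformity_obtain[of Q] by blast
  \<comment> \<open>The Cauchy condition is read as an eventual property of index pairs in the
    product filter, so that the finite intersection is again handled by
    \<open>eventually_basic_entourage\<close>.\<close>
  have "\<forall>\<^sub>F t in sequentially \<times>\<^sub>F sequentially. (s (fst t), s (snd t)) \<in> basic_entourage P"
  proof (rule eventually_basic_entourage[OF P(1)])
    fix \<rho> and r :: real assume "\<rho> \<in> F" "0 < r"
    from assms[OF this] show "\<forall>\<^sub>F t in sequentially \<times>\<^sub>F sequentially. \<rho> (s (fst t)) (s (snd t)) < r"
      by (simp add: eventually_prod_sequentially) blast
  qed
  then show "\<exists>N. \<forall>n\<ge>N. \<forall>m\<ge>N. Q (s n, s m)"
    using P(2) by (simp add: eventually_prod_sequentially) blast
qed

text \<open>All radii of a presentation are positive, so points at distance zero for every \<rho> in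
  \<open>F\<close> are related by every basic entourage, hence by every entourage.\<close>

lemma separated_eqI:
  assumes "separated_uniformity TYPE('a)" and "\<And>\<rho>. \<rho> \<in> F \<Longrightarrow> \<rho> x y = 0"
  shows "x = y"
proof -
  have "(x, y) \<in> U" if "U \<in> entourages" for U
  proof -
    obtain P where P: "P \<in> presentations F" "basic_entourage P \<subseteq> U"
      using \<open>U \<in> entourages\<close> by (rule entourage_obtain)
    then have "(x, y) \<in> basic_entourage P"
      using assms(2) by (fastforce simp: basic_entourage_def presentations_def)
    with P show ?thesis
      by blast
  qed
  then have "(x, y) \<in> \<Inter> (entourages :: ('a \<times> 'a) set set)"
    by blast
  then have "(x, y) \<in> Id"
    using assms(1) unfolding separated_uniformity_def by (rule subst[rotated])
  then show ?thesis
    by simp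
qed

text \<open>The class \<open>uniform_space\<close> does not include the Hausdorff property, so
  uniqueness of limits is derived from separation: both limits come within \<open>r / 2\<close> of a
  common value \<open>f t\<close>, for every \<open>r > 0\<close>.\<close>

lemma separated_tendsto_unique:
  fixes l l' :: 'a
  assumes sep: "separated_uniformity TYPE('a)" and "G \<noteq> bot" and "(f \<longlongrightarrow> l) G" and "(f \<longlongrightarrow> l') G"
  shows "l = l'"
proof (rule separated_eqI[OF sep])
  fix \<rho> assume \<rho>: "\<rho> \<in> F"
  \<comment> \<open>The summand \<open>0\<close> gives the bound the shape that
    \<open>field_le_epsilon\<close> expects.\<close>
  have "\<rho> l l' \<le> 0 + r" if "0 < r" for r
  proof -
    have "\<forall>\<^sub>F t in G. \<rho> l (f t) < r / 2 \<and> \<rho> l' (f t) < r / 2"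
      using assms \<rho> that by (intro eventually_conj eventually_less_tendsto) auto
    then obtain t where "\<rho> l (f t) < r / 2" "\<rho> l' (f t) < r / 2"
      using \<open>G \<noteq> bot\<close> eventually_happens' by blast
    then show ?thesis
      using triangle[OF \<rho>, of l l' "f t"] commute[OF \<rho>, of "f t" l'] by simp
  qed
  then show "\<rho> l l' = 0"
    using nonneg[OF \<rho>, of l l'] field_le_epsilon[of "\<rho> l l'" 0] by fastforce
qed

text \<open>A basic entourage inside \<open>V\<close> is preserved by \<open>T\<close>, hence by all
  iterates, and can itself be taken as \<open>W\<close>, whatever the point
  \<open>x\<close>.\<close>

lemma nonexpansive_imp_equicontinuous_iterates:
  assumes "nonexpansive F T"
  shows "equicontinuous_iterates T"
  unfolding equicontinuous_iterates_def
proof (intro allI ballI)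
  fix x :: 'a and V :: "('a \<times> 'a) set" assume "V \<in> entourages"
  then obtain P where P: "P \<in> presentations F" "basic_entourage P \<subseteq> V"
    by (rule entourage_obtain)
  have "((T ^^ n) x, (T ^^ n) y) \<in> basic_entourage P" if "(x, y) \<in> basic_entourage P" for n y
    using that assms P(1) by (induction n) (auto simp: nonexpansive_def)
  then show "\<exists>W\<in>entourages. \<forall>n\<ge>1. \<forall>y. (x, y) \<in> W \<longrightarrow> ((T ^^ n) x, (T ^^ n) y) \<in> V"
    using P basic_entourage_in_entourages by blast
qed

lemma equicontinuous_iterates_eventually:
  assumes "equicontinuous_iterates T" and "\<rho> \<in> F" and "0 < r"
  shows "\<forall>\<^sub>F y in nhds x. \<forall>n\<ge>1. \<rho> ((T ^^ n) x) ((T ^^ n) y) < r"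
proof -
  have "{(x, y). \<rho> x y < r} \<in> entourages"
    using eventually_less_uniformity[OF assms(2,3)] by (simp add: entourages_def case_prod_beta')
  then obtain W where "W \<in> entourages"
    and W: "\<And>n y. n \<ge> 1 \<Longrightarrow> (x, y) \<in> W \<Longrightarrow> \<rho> ((T ^^ n) x) ((T ^^ n) y) < r"
    using assms(1) unfolding equicontinuous_iterates_def by fast
  then have "\<forall>\<^sub>F p in uniformity. p \<in> W"
    by (simp add: entourages_def)
  then show ?thesis
    unfolding eventually_nhds_uniformity by (rule eventually_mono) (auto intro: W)
qed

text \<open>This is the case \<open>n = 1\<close> of equicontinuity.\<close>

lemma equicontinuous_iterates_continuous:
  fixes T :: "'a \<Rightarrow> 'a"
  assumes "equicontinuous_iterates T"
  shows "(T \<longlongrightarrow> T x) (nhds x)"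
proof (rule tendsto_if)
  fix \<rho> and r :: real assume "\<rho> \<in> F" "0 < r"
  from equicontinuous_iterates_eventually[OF assms this, of x]
  show "\<forall>\<^sub>F y in nhds x. \<rho> (T x) (T y) < r"
    by (rule eventually_mono) (auto dest: spec[of _ 1])
qed

text \<open>The entourage condition is tested on the single pseudometric \<rho> with radii slightly
  larger than \<open>\<rho> x y\<close>; letting the excess tend to zero turns it into a Lipschitz
  estimate.\<close>

lemma contraction_edge:
  assumes \<rho>: "\<rho> \<in> F" and "0 < \<alpha>"
    and contr: "\<And>P. P \<in> presentations F \<Longrightarrow> (x, y) \<in> basic_entourage P
      \<Longrightarrow> (T x, T y) \<in> basic_entourage (scale \<alpha> P)"
  shows "\<rho> (T x) (T y) \<le> \<alpha> * \<rho> x y"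
proof (rule field_le_epsilon)
  fix e :: real assume "0 < e"
  \<comment> \<open>The excess is \<open>e / \<alpha>\<close> so that scaling by \<alpha> leaves
    exactly \<open>e\<close>.\<close>
  define r where "r = \<rho> x y + e / \<alpha>"
  have "0 < e / \<alpha>"
    using \<open>0 < e\<close> \<open>0 < \<alpha>\<close> by simp
  then have "0 < r" "\<rho> x y < r"
    using nonneg[OF \<rho>, of x y] unfolding r_def by linarith+
  then have "\<rho> (T x) (T y) < \<alpha> * r"
    using contr[OF singleton_presentation[OF \<rho> \<open>0 < r\<close>]]
    by (simp add: basic_entourage_def scale_def)
  then show "\<rho> (T x) (T y) \<le> \<alpha> * \<rho> x y + e"
    using \<open>0 < \<alpha>\<close> by (simp add: r_def algebra_simps)
qed

end

section \<open>Iterates of a graph contraction with a fixed constant\<close>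

locale banach_graph_contraction = generating_pseudometrics F
  for F :: "('a::uniform_space \<Rightarrow> 'a \<Rightarrow> real) set" +
  fixes E :: "('a \<times> 'a) set" and T :: "'a \<Rightarrow> 'a" and \<alpha> :: real
  assumes edge_image: "\<forall>(x, y) \<in> E. (T x, T y) \<in> E"
    and alpha_pos: "0 < \<alpha>" and alpha_less_1: "\<alpha> < 1"
    and edge_contraction: "\<rho> \<in> F \<Longrightarrow> (x, y) \<in> E \<Longrightarrow> \<rho> (T x) (T y) \<le> \<alpha> * \<rho> x y"
begin

lemma sym_edge_funpow:
  assumes \<rho>: "\<rho> \<in> F" and "(x, y) \<in> sym_edges E"
  shows "\<rho> ((T ^^ n) x) ((T ^^ n) y) \<le> \<rho> x y * \<alpha> ^ n"
proof -
  have *: "((T ^^ n) x, (T ^^ n) y) \<in> E \<and> \<rho> ((T ^^ n) x) ((T ^^ n) y) \<le> \<rho> x y * \<alpha> ^ n"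
    if "(x, y) \<in> E" for x y
  proof (induction n)
    case (Suc n)
    then have "\<rho> ((T ^^ Suc n) x) ((T ^^ Suc n) y) \<le> \<alpha> * \<rho> ((T ^^ n) x) ((T ^^ n) y)"
      using edge_contraction[OF \<rho>] by simp
    also have "\<dots> \<le> \<alpha> * (\<rho> x y * \<alpha> ^ n)"
      using Suc alpha_pos by simp
    finally show ?case
      using Suc edge_image by (auto simp: mult_ac)
  qed (use that in simp)
  from assms(2) consider "(x, y) \<in> E" | "(y, x) \<in> E"
    by (auto simp: sym_edges_def)
  then show ?thesis
    using * commute[OF \<rho>] by cases metis+
qed

text \<open>By the triangle inequality the edge estimates add up along a path, so the total
  \<rho>-length of a path from \<open>x\<close> to \<open>y\<close> can serve as \<open>C\<close>.
  It depends on \<rho> and the path, but not on \<open>n\<close>.\<close>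

lemma component_funpow:
  assumes \<rho>: "\<rho> \<in> F" and "y \<in> component E x"
  obtains C where "0 \<le> C" and "\<And>n. \<rho> ((T ^^ n) x) ((T ^^ n) y) \<le> C * \<alpha> ^ n"
proof -
  from assms(2) have "(x, y) \<in> (sym_edges E)\<^sup>*"
    by (simp add: component_eq_rtrancl)
  then have "\<exists>C\<ge>0. \<forall>n. \<rho> ((T ^^ n) x) ((T ^^ n) y) \<le> C * \<alpha> ^ n"
  proof induction
    case base
    then show ?case
      using refl[OF \<rho>] by auto
  next
    case (step y z)
    then obtain C where C: "0 \<le> C" "\<And>n. \<rho> ((T ^^ n) x) ((T ^^ n) y) \<le> C * \<alpha> ^ n"
      by blast
    have "\<rho> ((T ^^ n) x) ((T ^^ n) z) \<le> (C + \<rho> y z) * \<alpha> ^ n" for n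
      using triangle[OF \<rho>, of "(T ^^ n) x" "(T ^^ n) z" "(T ^^ n) y"] C(2)[of n]
        sym_edge_funpow[OF \<rho> step.hyps(2), of n]
      by (simp add: distrib_right)
    then show ?case
      using C(1) nonneg[OF \<rho>, of y z] by (intro exI[of _ "C + \<rho> y z"]) auto
  qed
  then show ?thesis
    using that by blast
qed

lemma geometric_eventually_less:
  assumes "0 < r"
  shows "\<forall>\<^sub>F n in sequentially. C * \<alpha> ^ n < r"
proof (rule order_tendstoD(2)[OF _ assms])
  show "(\<lambda>n. C * \<alpha> ^ n) \<longlonglongrightarrow> 0"
    using alpha_pos alpha_less_1 by (intro tendsto_mult_right_zero LIMSEQ_power_zero) simp
qed

lemma Cauchy_orbit:
  assumes "T x \<in> component E x"
  shows "Cauchy (\<lambda>n. (T ^^ n) x)"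
proof (rule CauchyI_pseudometric)
  fix \<rho> and r :: real assume \<rho>: "\<rho> \<in> F" and "0 < r"
  obtain C where "0 \<le> C" and C: "\<And>n. \<rho> ((T ^^ n) x) ((T ^^ n) (T x)) \<le> C * \<alpha> ^ n"
    using component_funpow[OF \<rho> assms] by blast
  \<comment> \<open>\<open>B\<close> is the sum of the geometric series with first term
    \<open>C\<close> and ratio \<alpha>.\<close>
  define B where "B = C / (1 - \<alpha>)"
  have B: "C = B * (1 - \<alpha>)" "0 \<le> B"
    using \<open>0 \<le> C\<close> alpha_less_1 by (auto simp: B_def)
  \<comment> \<open>Keeping the subtracted tail makes the induction on \<open>k\<close> telescope,
    because \<open>B * \<alpha> ^ m - B * \<alpha> ^ Suc m = C * \<alpha> ^ m\<close>.\<close>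
  have bound: "\<rho> ((T ^^ n) x) ((T ^^ (n + k)) x) \<le> B * \<alpha> ^ n - B * \<alpha> ^ (n + k)" for n k
  proof (induction k)
    case (Suc k)
    \<comment> \<open>Since \<open>(T ^^ m) (T x) = (T ^^ Suc m) x\<close>, the constant
      \<open>C\<close> controls consecutive points of the orbit.\<close>
    have "\<rho> ((T ^^ (n + k)) x) ((T ^^ (n + Suc k)) x) \<le> C * \<alpha> ^ (n + k)"
      using C[of "n + k"] by (simp add: funpow_swap1)
    with Suc show ?case
      using triangle[OF \<rho>, of "(T ^^ n) x" "(T ^^ (n + Suc k)) x" "(T ^^ (n + k)) x"]
      by (simp add: B(1) algebra_simps)
  qed (simp add: refl[OF \<rho>])
  have le: "\<rho> ((T ^^ n) x) ((T ^^ (n + k)) x) \<le> B * \<alpha> ^ n" for n k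
    using bound[of n k] B(2) alpha_pos by (smt (verit) mult_nonneg_nonneg zero_le_power)
  obtain N where N: "\<And>n. n \<ge> N \<Longrightarrow> B * \<alpha> ^ n < r"
    using geometric_eventually_less[OF \<open>0 < r\<close>, of B] by (auto simp: eventually_sequentially)
  have "\<rho> ((T ^^ m) x) ((T ^^ n) x) < r" if "m \<ge> N" "n \<ge> N" for m n
  proof (cases "m \<le> n")
    case True
    then show ?thesis
      using le[of m "n - m"] N[OF that(1)] by simp
  next
    case False
    then show ?thesis
      using le[of n "m - n"] N[OF that(2)] commute[OF \<rho>, of "(T ^^ m) x"] by simp
  qed
  then show "\<exists>N. \<forall>m\<ge>N. \<forall>n\<ge>N. \<rho> ((T ^^ m) x) ((T ^^ n) x) < r"
    by blast
qed

text \<open>The distance from \<open>z\<close> to \<open>(T ^^ n) y\<close> is split at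
  \<open>(T ^^ n) x\<close> and \<open>(T ^^ n) a\<close>, where \<open>a\<close> is a point of the
  component near \<open>y\<close>. The three parts are small by convergence, by decay along a path,
  and by equicontinuity at \<open>y\<close>.\<close>

lemma closure_orbit_tendsto:
  assumes equi: "equicontinuous_iterates T" and lim: "(\<lambda>n. (T ^^ n) x) \<longlonglongrightarrow> z"
    and y: "y \<in> closure (component E x)"
  shows "(\<lambda>n. (T ^^ n) y) \<longlonglongrightarrow> z"
proof (rule tendsto_if)
  fix \<rho> and r :: real assume \<rho>: "\<rho> \<in> F" and "0 < r"
  then have r3: "0 < r / 3"
    by simp
  \<comment> \<open>The point \<open>a\<close> works for all \<open>n \<ge> 1\<close> at once and is
    chosen before \<open>C\<close>, which may therefore depend on it.\<close>
  obtain a where "a \<in> component E x"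
    and a: "\<And>n. n \<ge> 1 \<Longrightarrow> \<rho> ((T ^^ n) y) ((T ^^ n) a) < r / 3"
    using closure_obtain_eventually[OF y equicontinuous_iterates_eventually[OF equi \<rho> r3]] by blast
  obtain C where C: "\<And>n. \<rho> ((T ^^ n) x) ((T ^^ n) a) \<le> C * \<alpha> ^ n"
    using component_funpow[OF \<rho> \<open>a \<in> component E x\<close>] by blast
  from eventually_less_tendsto[OF lim \<rho> r3] geometric_eventually_less[OF r3, of C]
    \<comment> \<open>Equicontinuity covers only the iterates with \<open>n \<ge> 1\<close>, so
      \<open>n = 0\<close> is discarded.\<close>
    eventually_ge_at_top[of 1]
  show "\<forall>\<^sub>F n in sequentially. \<rho> z ((T ^^ n) y) < r"
  proof eventually_elim
    case (elim n)
    then show ?case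
      using a[of n] C[of n] commute[OF \<rho>, of "(T ^^ n) y" "(T ^^ n) a"]
        triangle[OF \<rho>, of z "(T ^^ n) y" "(T ^^ n) x"]
        triangle[OF \<rho>, of "(T ^^ n) x" "(T ^^ n) y" "(T ^^ n) a"]
      by linarith
  qed
qed

lemma picard_on_closure_component:
  assumes sep: "separated_uniformity TYPE('a)" and complete: "sequentially_complete TYPE('a)"
    and equi: "equicontinuous_iterates T" and Tx: "T x \<in> component E x"
  shows "picard_on (closure (component E x)) T"
proof -
  let ?A = "component E x"
  obtain z where z: "(\<lambda>n. (T ^^ n) x) \<longlonglongrightarrow> z"
    using Cauchy_orbit[OF Tx] complete by (auto simp: sequentially_complete_def convergent_def)
  \<comment> \<open>The shifted orbit converges to \<open>T z\<close> by continuity and to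
    \<open>z\<close> as a tail of the orbit, so \<open>z\<close> is fixed.\<close>
  have "(\<lambda>n. T ((T ^^ n) x)) \<longlonglongrightarrow> T z"
    using equicontinuous_iterates_continuous[OF equi] z by (rule filterlim_compose)
  moreover have "(\<lambda>n. T ((T ^^ n) x)) \<longlonglongrightarrow> z"
    using LIMSEQ_Suc[OF z] by simp
  ultimately have "T z = z"
    by (rule separated_tendsto_unique[OF sep sequentially_bot])
  have "(T ^^ n) x \<in> closure ?A" for n
    using funpow_mem_component[OF edge_image Tx] closure_subset by blast
  then have "z \<in> closure ?A"
    using z by (intro Lim_in_closed_set[where f = "\<lambda>n. (T ^^ n) x"]) auto
  \<comment> \<open>The orbit of a fixed point is constant, yet it has to converge to
    \<open>z\<close>.\<close>
  have "y = z" if "y \<in> closure ?A" "T y = y" for y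
  proof -
    have "(T ^^ n) y = y" for n
      using \<open>T y = y\<close> by (induction n) auto
    then have "(\<lambda>n. y) \<longlonglongrightarrow> z"
      using closure_orbit_tendsto[OF equi z \<open>y \<in> closure ?A\<close>] by simp
    then show ?thesis
      using separated_tendsto_unique[OF sep sequentially_bot tendsto_const] by blast
  qed
  moreover have "T ` closure ?A \<subseteq> closure ?A"
  proof (rule image_closure_subset)
    show "continuous_on (closure ?A) T"
      unfolding continuous_on_def
      using tendsto_mono[OF _ equicontinuous_iterates_continuous[OF equi]]
      by (simp add: at_within_def)
    show "T ` ?A \<subseteq> closure ?A"
      using component_trans[OF Tx component_image[OF edge_image]] closure_subset by blast
  qed simp
  ultimately show ?thesis
    using \<open>T z = z\<close> \<open>z \<in> closure ?A\<close> closure_orbit_tendsto[OF equi z]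
    unfolding picard_on_def by blast
qed

end

section \<open>Return from pseudometric estimates to entourages and the final statement\<close>

lemma (in generating_pseudometrics) banach_contraction_picard_on:
  assumes "banach_contraction F E T" and "nonexpansive F T \<or> equicontinuous_iterates T"
    and "separated_uniformity TYPE('a)" and "sequentially_complete TYPE('a)"
    and "T x \<in> component E x"
  shows "picard_on (closure (component E x)) T"
proof -
  obtain \<alpha> where "0 < \<alpha>" "\<alpha> < 1"
    and contr: "\<And>x y P. P \<in> presentations F \<Longrightarrow> (x, y) \<in> E \<Longrightarrow> (x, y) \<in> basic_entourage P
      \<Longrightarrow> (T x, T y) \<in> basic_entourage (scale \<alpha> P)"
    using assms(1) unfolding banach_contraction_def by blast
  interpret banach_graph_contraction F E T \<alpha>
  proof
    show "\<forall>(x, y) \<in> E. (T x, T y) \<in> E"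
      using assms(1) unfolding banach_contraction_def by blast
    show "\<rho> (T x) (T y) \<le> \<alpha> * \<rho> x y" if "\<rho> \<in> F" "(x, y) \<in> E" for \<rho> x y
      using that contr \<open>0 < \<alpha>\<close> by (intro contraction_edge)
  qed fact+
  show ?thesis
    using assms nonexpansive_imp_equicontinuous_iterates
    by (blast intro: picard_on_closure_component)
qed

theorem theorem5:
  fixes F :: "('a::uniform_space \<Rightarrow> 'a \<Rightarrow> real) set"
    and E :: "('a \<times> 'a) set"
    and T :: "'a \<Rightarrow> 'a"
  assumes "separated_uniformity TYPE('a)"
    and "F \<noteq> {}"
    and "\<forall>\<rho> \<in> F. pseudometric \<rho>"
    and "generates_uniformity F"
    and "Id \<subseteq> E"
    and "sequentially_complete TYPE('a)"
    and "banach_contraction F E T"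
  shows "(nonexpansive F T \<or> equicontinuous_iterates T \<longrightarrow>
            (\<forall>x. T x \<in> component E x \<longrightarrow> picard_on (closure (component E x)) T)) \<and>
         (weakly_connected E \<longrightarrow>
            (\<forall>S. banach_contraction F E S \<and> nonexpansive F S \<longrightarrow> picard_on UNIV S))"
proof -
  interpret generating_pseudometrics F
    using assms(3,4) by unfold_locales auto
  \<comment> \<open>The map is a variable \<open>S\<close> here because the weakly connected case
    concerns all nonexpansive contractions, not only \<open>T\<close>.\<close>
  have picard: "picard_on (closure (component E x)) S"
    if "banach_contraction F E S" "nonexpansive F S \<or> equicontinuous_iterates S"
      "S x \<in> component E x" for S x
    using banach_contraction_picard_on[OF that(1,2) assms(1,6) that(3)] .
  have "picard_on UNIV S"
    if "weakly_connected E" "banach_contraction F E S" "nonexpansive F S" for S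
    \<comment> \<open>\<open>undefined\<close> is an arbitrary base point: by weak connectedness its
      component is \<open>UNIV\<close>, which contains its image under \<open>S\<close> and equals
      its own closure.\<close>
    using picard[of S undefined] that by (simp add: weakly_connected_def)
  with picard[OF assms(7)] show ?thesis
    by blast
qed

end
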